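(* Let $g\in\mathbb{R}_5^+$. The following equivalences hold. (i) ($f*g\in\mathcal{H}_m$ for every $m\in\{1,\dots,5\}$ and every $f\in\mathcal{H}_m$) if and only if $g*Q^5\in\mathcal{H}_5^\star$ and $\frac{g*Q_1^3}{x}\in\mathcal{H}_3^\star$. (ii) ($f*g\in\mathcal{H}_m^\star$ for every $m\in\{1,\dots,5\}$ and every $f\in\mathcal{H}_m^\star$) if and only if $g*Q^5\in\mathcal{H}_5^\star$ and $\frac{g*Q_1^3}{x}\in\mathcal{H}_3^\star$. Thus $X_5=Y_5$.
   Context: $\mathbb{R}_n^+$ denotes the set of real polynomials of degree $n$ all of whose coefficients (of $x^0,\dots,x^n$) are positive. $\mathcal{H}_n$ is the set of $f\in\mathbb{R}_n^+$ all of whose complex zeros $z$ satisfy $\Re(z)<0$. $\mathcal{H}_n^\star$ is the set of real polynomials $f(x)=\sum_{i=0}^n a_ix^i$ with $a_0,a_n>0$, $a_i\ge 0$ for $1\le i\le n-1$, all of whose complex zeros $z$ satisfy $\Re(z)\le 0$. The Hadamard product of $f(x)=\sum_{i=0}^n a_ix^i$ and $g(x)=\sum_{i=0}^m b_ix^i$ is $(f*g)(x)=\sum_{i=0}^{\min\{n,m\}}a_ib_ix^i$. $X_n=\{g\in\mathbb{R}_n^+ : f*g\in\mathcal{H}_m \text{ for all } 1\le m\le n \text{ and all } f\in\mathcal{H}_m\}$. $Q^k(x)=(x^2+1)^l$ if $k=2l$, and $Q^k(x)=(x^2+1)^l+x(x^2+1)^l$ if $k=2l+1$; $Q_m^k(x)=x^mQ^k(x)$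 for integers $m\ge 0$. $Y_n=\{g\in\mathbb{R}_n^+ : \frac{(g*Q_m^k)(x)}{x^m}\in\mathcal{H}_k^\star \text{ for all integers } k\ge 2,\ m\ge 0 \text{ with } k+m\le n\}$. *)

theory Defs
  imports Complex_Main "HOL-Computational_Algebra.Polynomial"
begin

definition pos_polys :: "nat \<Rightarrow> real poly set" where
  "pos_polys n = {f. degree f = n \<and> (\<forall>i\<le>n. coeff f i > 0)}"

definition hurwitz :: "nat \<Rightarrow> real poly set" where
  "hurwitz n = {f \<in> pos_polys n.
     \<forall>z::complex. poly (map_poly of_real f) z = 0 \<longrightarrow> Re z < 0}"

definition hurwitz_star :: "nat \<Rightarrow> real poly set" where
  "hurwitz_star n = {f. degree f = n \<and> coeff f 0 > 0 \<and> coeff f n > 0 \<and>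
     (\<forall>i. 1 \<le> i \<and> i < n \<longrightarrow> coeff f i \<ge> 0) \<and>
     (\<forall>z::complex. poly (map_poly of_real f) z = 0 \<longrightarrow> Re z \<le> 0)}"

definition hadamard :: "real poly \<Rightarrow> real poly \<Rightarrow> real poly" where
  "hadamard f g = (\<Sum>i\<le>min (degree f) (degree g). monom (coeff f i * coeff g i) i)"

definition X_set :: "nat \<Rightarrow> real poly set" where
  "X_set n = {g \<in> pos_polys n.
     \<forall>m\<in>{1..n}. \<forall>f\<in>hurwitz m. hadamard f g \<in> hurwitz m}"

(* [:1, 0, 1:] is x^2 + 1 and [:0, 1:] is x. *)
definition Q_poly :: "nat \<Rightarrow> real poly" where
  "Q_poly k = (if even k then [:1, 0, 1:] ^ (k div 2)
     else [:1, 0, 1:] ^ (k div 2) + [:0, 1:] * [:1, 0, 1:] ^ (k div 2))"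

definition Q_shift :: "nat \<Rightarrow> nat \<Rightarrow> real poly" where
  "Q_shift m k = monom 1 m * Q_poly k"

(* The division by x^m is exact, because x^m divides Q_shift m k and hence also its
   Hadamard product with any g. *)
definition Y_set :: "nat \<Rightarrow> real poly set" where
  "Y_set n = {g \<in> pos_polys n.
     \<forall>k m. 2 \<le> k \<and> k + m \<le> n \<longrightarrow>
       hadamard g (Q_shift m k) div monom 1 m \<in> hurwitz_star k}"

end

theory Submission
  imports Defs "HOL-Computational_Algebra.Fundamental_Theorem_Algebra"
begin

text \<open>
  Write $f = p(x^2) + x\,q(x^2)$. For degree 5, $f$ with positive coefficients is Hurwitz iff the
  Bezout form of $p$ and $q$, with entries $a_1a_2 - a_0a_3$, $a_1a_4 - a_0a_5$, $a_3a_4 - a_2a_5$,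
  is positive definite. For fixed $p$ this form is linear in $q$, so one may split
  $q = \mu p + (c_1 + c_3 y)$ with $\mu, c_1, c_3 > 0$ and treat both parts of $f * g$
  separately: the part from $\mu p$ stays positive semidefinite by the condition on $g * Q^5$,
  because $p$ is real-rooted, that is $4a_0a_4 \le a_2^2$; the part from $c_1 + c_3 y$ stays
  positive definite because it is the quartic Routh-Hurwitz inequality, which only needs
  $b_0b_3 \le b_1b_2$ and $b_1b_4 \le b_2b_3$.

  Conversely, $Q^k_m$ is the limit of the Hurwitz polynomials $Q^k_m(x + \varepsilon)$, and zeros
  in the closed left half plane survive coefficientwise limits of constant degree, because
  $|F(z)| \ge |\mathrm{lc}\,F| (\Re z)^{\deg F}$ whenever all zeros of $F$ lie there and $\Re z > 0$.
\<close>

section \<open>Real polynomials at complex arguments\<close>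

lemma poly_map_of_real_add:
  "poly (map_poly of_real (p + q)) z = poly (map_poly of_real p) z + poly (map_poly of_real q) z"
  for z :: complex
proof -
  have "map_poly of_real (p + q) = map_poly of_real p + (map_poly of_real q :: complex poly)"
    by (intro poly_eqI) (simp add: coeff_map_poly)
  then show ?thesis by simp
qed

lemma poly_map_of_real_mult:
  "poly (map_poly of_real (p * q)) z = poly (map_poly of_real p) z * poly (map_poly of_real q) z"
  for z :: complex
  by (induction p)
    (simp_all add: poly_map_of_real_add map_poly_pCons map_poly_smult algebra_simps)

lemma poly_map_of_real_of_real:
  "poly (map_poly of_real p) (of_real x :: complex) = of_real (poly p x)"
  by (induction p) (simp_all add: map_poly_pCons)

lemma poly_map_of_real_pcompose:
  "poly (map_poly of_real (pcompose p q)) z = poly (map_poly of_real p) (poly (map_poly of_real q) z)"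
  for z :: complex
  by (induction p)
    (simp_all add: pcompose_pCons poly_map_of_real_add poly_map_of_real_mult map_poly_pCons)

lemma poly_map_of_real_sum:
  fixes z :: complex
  assumes "degree f \<le> n"
  shows "poly (map_poly of_real f) z = (\<Sum>i\<le>n. of_real (coeff f i) * z ^ i)"
proof -
  have "poly (map_poly of_real f) z = (\<Sum>i\<le>degree f. of_real (coeff f i) * z ^ i)"
    by (simp add: poly_altdef degree_map_poly coeff_map_poly)
  also have "\<dots> = (\<Sum>i\<le>n. of_real (coeff f i) * z ^ i)"
    using assms by (intro sum.mono_neutral_left) (auto simp: coeff_eq_0)
  finally show ?thesis .
qed

lemma complex_root_exists:
  fixes f :: "real poly"
  assumes "degree f > 0"
  shows "\<exists>z::complex. poly (map_poly of_real f) z = 0"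
  using assms by (intro alg_closed_imp_poly_has_root) (simp add: degree_map_poly)

text \<open>The divisor has the zeros z and \<open>cnj z\<close>. The remainder is a real linear
  polynomial a + b x that vanishes at the nonreal z, which forces a = b = 0.\<close>

lemma quadratic_dvd_of_complex_root:
  fixes f :: "real poly" and z :: complex
  assumes "poly (map_poly of_real f) z = 0" "Im z \<noteq> 0"
  shows "[:(cmod z)\<^sup>2, - 2 * Re z, 1:] dvd f"
proof -
  define q where "q = [:(cmod z)\<^sup>2, - 2 * Re z, 1:]"
  have q0: "poly (map_poly of_real q) z = 0"
    by (simp add: q_def map_poly_pCons complex_eq_iff cmod_power2[unfolded power2_eq_square]
      power2_eq_square algebra_simps)
  have "degree (f mod q) < 2"
    using degree_mod_less[of q f] by (auto simp: q_def)
  then have "f mod q = [:coeff (f mod q) 0, coeff (f mod q) 1:]"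
    by (intro poly_eqI) (auto simp: coeff_pCons coeff_eq_0 split: nat.splits)
  then obtain a b where r: "f mod q = [:a, b:]" by blast
  have "f = q * (f div q) + f mod q" by simp
  then have "poly (map_poly of_real (f mod q)) z = 0"
    using assms(1) q0 by (metis add_0 mult_zero_left poly_map_of_real_add poly_map_of_real_mult)
  then have "f mod q = 0"
    using assms(2) by (auto simp: r map_poly_pCons complex_eq_iff)
  then show ?thesis by (simp add: q_def dvd_eq_mod_eq_0)
qed

subsection \<open>Necessity of the Routh-Hurwitz inequalities\<close>

text \<open>Free of sign conditions on coefficients, so that it passes to every factor of a
  product.\<close>

definition stable :: "real poly \<Rightarrow> bool" where
  "stable f \<longleftrightarrow> (\<forall>z::complex. poly (map_poly of_real f) z = 0 \<longrightarrow> Re z < 0)"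

lemma stable_mult_iff: "stable (p * q) \<longleftrightarrow> stable p \<and> stable q"
  by (auto simp: stable_def poly_map_of_real_mult)

lemma stable_linear_factor: "stable [:- x, 1:] \<longleftrightarrow> x < 0"
  by (auto simp: stable_def map_poly_pCons dest: spec[of _ "of_real x"])

lemma stable_degree_1:
  assumes "stable f" "degree f = 1"
  obtains l a where "f = smult l [:a, 1:]" "a > 0"
proof -
  obtain b l where f: "f = [:b, l:]" "l \<noteq> 0"
    using assms(2) by (metis One_nat_def degree1_coeffs)
  then have "f = smult l [:b / l, 1:]" by simp
  moreover have "b / l > 0"
    using assms(1) f by (force simp: stable_def map_poly_pCons dest: spec[of _ "of_real (- b / l)"])
  ultimately show ?thesis using that by blast
qed

text \<open>A nonreal zero brings its conjugate; otherwise two negative real zeros are combined.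
  Splitting off such factors turns the inequalities in degrees 3 to 5 into polynomial identities in
  positive parameters.\<close>

lemma stable_quadratic_factor:
  assumes "stable f" "degree f \<ge> 2"
  shows "\<exists>b c g. f = [:c, b, 1:] * g \<and> b > 0 \<and> c > 0"
proof -
  have nonreal: ?thesis if root: "poly (map_poly of_real f) z = 0" "Im z \<noteq> 0" for z :: complex
  proof -
    have "Re z < 0" using assms(1) that by (simp add: stable_def)
    moreover have "(cmod z)\<^sup>2 > 0" using that(2) by auto
    moreover obtain g where "f = [:(cmod z)\<^sup>2, - 2 * Re z, 1:] * g"
      using quadratic_dvd_of_complex_root[OF root] by (elim dvdE)
    ultimately show ?thesis by (intro exI[of _ "- 2 * Re z"] exI[of _ "(cmod z)\<^sup>2"] exI[of _ g]) simp
  qed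
  show ?thesis
  proof (cases "\<exists>z::complex. poly (map_poly of_real f) z = 0 \<and> Im z \<noteq> 0")
    case True
    then show ?thesis using nonreal by blast
  next
    case False
    \<comment> \<open>Stated for divisors because it is applied to f and again to the cofactor
      \<open>f1\<close>.\<close>
    have real_root: "\<exists>x. poly h x = 0" if h: "h dvd f" "degree h > 0" for h
    proof -
      obtain z :: complex where z: "poly (map_poly of_real h) z = 0"
        using complex_root_exists[OF h(2)] by blast
      then have "Im z = 0" using False h(1) by (auto simp: poly_map_of_real_mult elim!: dvdE)
      then have "z = of_real (Re z)" by (simp add: complex_eq_iff)
      with z show ?thesis by (metis of_real_eq_0_iff poly_map_of_real_of_real)
    qed
    obtain x where "poly f x = 0" using real_root[of f] assms(2) by auto
    then obtain f1 where f1: "f = [:- x, 1:] * f1" by (auto simp: poly_eq_0_iff_dvd elim: dvdE)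
    with assms(2) have "f1 \<noteq> 0" by auto
    with f1 have "degree f = Suc (degree f1)" by (simp add: degree_mult_eq del: mult_pCons_left)
    then have "degree f1 > 0" using assms(2) by simp
    moreover have "f1 dvd f" unfolding f1 by (rule dvd_triv_right)
    ultimately obtain y where "poly f1 y = 0" using real_root by blast
    then obtain f2 where f2: "f1 = [:- y, 1:] * f2" by (auto simp: poly_eq_0_iff_dvd elim: dvdE)
    have "x < 0" "y < 0"
      using assms(1) unfolding f1 f2 stable_mult_iff stable_linear_factor by auto
    moreover have "f = ([:- x, 1:] * [:- y, 1:]) * f2"
      unfolding f1 f2 by (simp only: mult.assoc)
    then have "f = [:x * y, - x - y, 1:] * f2" by (simp add: algebra_simps)
    ultimately show ?thesis
      by (intro exI[of _ "- x - y"] exI[of _ "x * y"] exI[of _ f2]) (simp add: mult_neg_neg)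
  qed
qed

text \<open>Orlando's formula: up to sign and a power of the leading coefficient, the difference of
  the two sides is the product of all sums of two zeros. Here b comes from the pair of the
  quadratic, and a^2 + ab + c from pairing each of its zeros with -a.\<close>

lemma stable_degree_3:
  assumes "stable f" "degree f = 3"
  shows "coeff f 0 * coeff f 3 < coeff f 1 * coeff f 2"
proof -
  obtain b c g where f: "f = [:c, b, 1:] * g" and bc: "b > 0" "c > 0"
    using stable_quadratic_factor[OF assms(1)] assms(2) by fastforce
  have "g \<noteq> 0" using assms(2) f by auto
  then have "degree g = 1" using assms(2) f by (simp add: degree_mult_eq del: mult_pCons_left)
  moreover have "stable g" using assms(1) unfolding f stable_mult_iff by simp
  ultimately obtain l a where g: "g = smult l [:a, 1:]" "a > 0" using stable_degree_1 by blast
  then have l: "l \<noteq> 0" using \<open>g \<noteq> 0\<close> by auto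
  have "coeff f 1 * coeff f 2 - coeff f 0 * coeff f 3 = l\<^sup>2 * (b * (a\<^sup>2 + a * b + c))"
    unfolding f g by (simp add: numeral_eq_Suc algebra_simps power2_eq_square)
  moreover have "\<dots> > 0"
    using l bc g(2) by (intro mult_pos_pos add_pos_pos) auto
  ultimately show ?thesis by linarith
qed

lemma stable_degree_4:
  assumes "stable f" "degree f = 4" "coeff f 4 > 0"
  shows "coeff f 0 * coeff f 3 ^ 2 + coeff f 1 ^ 2 * coeff f 4 < coeff f 1 * coeff f 3 * coeff f 2"
proof -
  obtain b c g where f: "f = [:c, b, 1:] * g" and bc: "b > 0" "c > 0"
    using stable_quadratic_factor[OF assms(1)] assms(2) by fastforce
  have "g \<noteq> 0" using assms(2) f by auto
  then have dg: "degree g = 2" using assms(2) f by (simp add: degree_mult_eq del: mult_pCons_left)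
  moreover have "stable g" using assms(1) unfolding f stable_mult_iff by simp
  ultimately obtain d e h where g: "g = [:e, d, 1:] * h" and de: "d > 0" "e > 0"
    using stable_quadratic_factor by (metis order_refl)
  have "h \<noteq> 0" using \<open>g \<noteq> 0\<close> g by auto
  then have "degree h = 0" using dg g by (simp add: degree_mult_eq del: mult_pCons_left)
  then obtain l where h: "h = [:l:]" by (auto elim: degree_eq_zeroE)
  \<comment> \<open>The inequality is cubic in the coefficients, so the sign of the leading
    coefficient matters, unlike in degrees 3 and 5.\<close>
  have l: "l > 0" using assms(3) unfolding f g h by (simp add: numeral_eq_Suc)
  \<comment> \<open>Orlando's formula again: -b and -d are the sums within the two pairs, and the
    last factor is the product of the four mixed sums, a resultant.\<close>
  have "coeff f 1 * coeff f 3 * coeff f 2 - coeff f 0 * coeff f 3 ^ 2 - coeff f 1 ^ 2 * coeff f 4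
      = l ^ 3 * (b * d * ((c - e)\<^sup>2 + (b + d) * (b * e + c * d)))"
    unfolding f g h by (simp add: numeral_eq_Suc algebra_simps)
  moreover have "\<dots> > 0"
    using l bc de by (intro mult_pos_pos add_nonneg_pos add_pos_pos) auto
  ultimately show ?thesis by linarith
qed

text \<open>The diagonal entries and the determinant of the Bezout form, expressed through the
  parameters of two quadratic factors and one linear factor.\<close>

lemma stable_degree_5:
  assumes "stable f" "degree f = 5"
  shows "coeff f 0 * coeff f 3 < coeff f 1 * coeff f 2" (is ?A)
    and "coeff f 2 * coeff f 5 < coeff f 3 * coeff f 4" (is ?B)
    and "(coeff f 1 * coeff f 4 - coeff f 0 * coeff f 5)\<^sup>2
      < (coeff f 1 * coeff f 2 - coeff f 0 * coeff f 3) * (coeff f 3 * coeff f 4 - coeff f 2 * coeff f 5)" (is ?C)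
proof -
  obtain b c g where f: "f = [:c, b, 1:] * g" and bc: "b > 0" "c > 0"
    using stable_quadratic_factor[OF assms(1)] assms(2) by fastforce
  have "g \<noteq> 0" using assms(2) f by auto
  then have dg: "degree g = 3" using assms(2) f by (simp add: degree_mult_eq del: mult_pCons_left)
  moreover have sg: "stable g" using assms(1) unfolding f stable_mult_iff by simp
  ultimately obtain d e h where g: "g = [:e, d, 1:] * h" and de: "d > 0" "e > 0"
    using stable_quadratic_factor[of g] by fastforce
  have "h \<noteq> 0" using \<open>g \<noteq> 0\<close> g by auto
  then have "degree h = 1" using dg g by (simp add: degree_mult_eq del: mult_pCons_left)
  moreover have "stable h" using sg unfolding g stable_mult_iff by simp
  ultimately obtain l a where h: "h = smult l [:a, 1:]" "a > 0" using stable_degree_1 by blast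
  then have l: "l \<noteq> 0" using \<open>h \<noteq> 0\<close> by auto
  note pos = bc de h(2)
  have co: "coeff f 0 = l * (a * c * e)"
    "coeff f 1 = l * (c * e + a * (b * e + c * d))"
    "coeff f 2 = l * (a * (c + e + b * d) + b * e + c * d)"
    "coeff f 3 = l * (a * (b + d) + c + e + b * d)"
    "coeff f 4 = l * (a + b + d)" "coeff f 5 = l"
    unfolding f g h by (simp_all add: numeral_eq_Suc algebra_simps)
  have "coeff f 1 * coeff f 2 - coeff f 0 * coeff f 3 = l\<^sup>2 * 
      (c * e * (b * e + c * d) + a * (b * e + c * d) * (a * b * d + b * e + c * d)
       + a * a * (b * e * e + c * c * d))"
    unfolding co by algebra
  also have "\<dots> > 0" using l pos by (intro mult_pos_pos add_pos_pos) auto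
  finally show ?A by linarith
  have "coeff f 3 * coeff f 4 - coeff f 2 * coeff f 5
      = l\<^sup>2 * ((a + b + d) * (a * (b + d)) + b * d * (b + d) + b * c + d * e)"
    unfolding co by algebra
  also have "\<dots> > 0" using l pos by (intro mult_pos_pos add_pos_pos) auto
  finally show ?B by linarith
  \<comment> \<open>The determinant is the Orlando product: b and d from the two pairs, two factors
    from pairing their zeros with -a, and the resultant of the mixed sums.\<close>
  have "(coeff f 1 * coeff f 2 - coeff f 0 * coeff f 3) * (coeff f 3 * coeff f 4 - coeff f 2 * coeff f 5)
      - (coeff f 1 * coeff f 4 - coeff f 0 * coeff f 5)\<^sup>2
      = l ^ 4 * (b * d * (a\<^sup>2 + a * b + c) * (a\<^sup>2 + a * d + e)
          * ((c - e)\<^sup>2 + (b + d) * (b * e + c * d)))"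
    unfolding co by algebra
  also have "\<dots> > 0"
    using l pos by (intro mult_pos_pos add_nonneg_pos add_pos_pos) auto
  finally show ?C by linarith
qed

subsection \<open>Sufficiency of the Routh-Hurwitz inequalities\<close>

text \<open>
  With $P = \alpha z^2 L + N$, a zero would give $zL = -P(1 + \mu z)$; then
  $\Re (P\,\overline{zL})$ is $\le 0$ from this equation and $\ge 0$ from the continued fraction.
\<close>

lemma stieltjes_fraction_nonzero:
  fixes z :: complex and \<alpha> \<gamma> \<mu> d a k :: real
  assumes "Re z \<ge> 0" "\<alpha> \<ge> 0" "\<gamma> \<ge> 0" "\<mu> \<ge> 0" "d \<ge> 0" "a > 0" "k > 0"
  defines "N \<equiv> of_real d * z\<^sup>2 + of_real a"
  defines "L \<equiv> of_real \<gamma> * N + of_real k"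
  shows "(of_real \<alpha> * z\<^sup>2 * L + N) * (1 + of_real \<mu> * z) + z * L \<noteq> 0"
proof
  define P where "P = of_real \<alpha> * z\<^sup>2 * L + N"
  assume "(of_real \<alpha> * z\<^sup>2 * L + N) * (1 + of_real \<mu> * z) + z * L = 0"
  then have zL: "z * L = - (P * (1 + of_real \<mu> * z))"
    by (simp add: P_def add_eq_0_iff2)
  have "Re (P * cnj (z * L)) = - ((cmod P)\<^sup>2 * (1 + \<mu> * Re z))"
    unfolding zL cmod_power2 by (simp add: power2_eq_square algebra_simps)
  \<comment> \<open>The continued fraction is climbed from the inside: passing from N against z to N
    against z L and then to P against z L adds a nonnegative multiple of \<open>Re z\<close> each
    time.\<close>
  moreover have "Re (P * cnj (z * L)) \<ge> 0"
  proof -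
    have "Re (N * cnj z) = (d * (cmod z)\<^sup>2 + a) * Re z"
      unfolding N_def cmod_power2 by (simp add: power2_eq_square algebra_simps)
    moreover have "Re (N * cnj (z * L)) = \<gamma> * (cmod N)\<^sup>2 * Re z + k * Re (N * cnj z)"
      unfolding L_def cmod_power2 by (simp add: power2_eq_square algebra_simps)
    moreover have "Re (P * cnj (z * L)) = \<alpha> * (cmod z)\<^sup>2 * (cmod L)\<^sup>2 * Re z + Re (N * cnj (z * L))"
      unfolding P_def cmod_power2 by (simp add: power2_eq_square algebra_simps)
    ultimately show ?thesis using assms(1-7) by simp
  qed
  ultimately have "(cmod P)\<^sup>2 * (1 + \<mu> * Re z) \<le> 0" by linarith
  moreover have "1 + \<mu> * Re z > 0" using assms(1,4) by (simp add: add_pos_nonneg)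
  ultimately have "(cmod P)\<^sup>2 \<le> 0"
    by (simp add: mult_le_0_iff)
  then have "P = 0" by simp
  with zL have "z = 0 \<or> L = 0" by simp
  then show False
  proof
    assume "z = 0"
    with \<open>P = 0\<close> \<open>a > 0\<close> show False by (simp add: P_def N_def)
  next
    assume "L = 0"
    with \<open>P = 0\<close> \<open>k > 0\<close> show False by (simp add: P_def L_def)
  qed
qed

lemma hurwitz_iff: "f \<in> hurwitz n \<longleftrightarrow> f \<in> pos_polys n \<and> stable f"
  by (auto simp: hurwitz_def stable_def)

text \<open>Degrees 1 to 3 are the cases \<open>\<alpha> = \<mu> = 0\<close> of
  \<open>stieltjes_fraction_nonzero\<close>, with N the even part of f and z L the odd part.\<close>

lemma hurwitz_1I:
  assumes "f \<in> pos_polys 1"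
  shows "f \<in> hurwitz 1"
proof -
  have "degree f \<le> 1" and pos: "coeff f 0 > 0" "coeff f 1 > 0"
    using assms by (auto simp: pos_polys_def)
  then have "poly (map_poly of_real f) z = of_real (coeff f 0) + z * of_real (coeff f 1)" for z :: complex
    by (subst poly_map_of_real_sum[of f 1]) simp_all
  then show ?thesis
    using assms stieltjes_fraction_nonzero[of _ 0 0 0 0 "coeff f 0" "coeff f 1"] pos
    by (auto simp: hurwitz_iff stable_def not_less[symmetric])
qed

lemma hurwitz_2I:
  assumes "f \<in> pos_polys 2"
  shows "f \<in> hurwitz 2"
proof -
  have "degree f \<le> 2" and pos: "coeff f 0 > 0" "coeff f 1 > 0" "coeff f 2 > 0"
    using assms by (auto simp: pos_polys_def)
  then have "poly (map_poly of_real f) z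
      = of_real (coeff f 2) * z\<^sup>2 + of_real (coeff f 0) + z * of_real (coeff f 1)" for z :: complex
    by (subst poly_map_of_real_sum[of f 2]) (simp_all add: numeral_2_eq_2)
  then show ?thesis
    using assms stieltjes_fraction_nonzero[of _ 0 0 0 "coeff f 2" "coeff f 0" "coeff f 1"] pos
    by (auto simp: hurwitz_iff stable_def not_less[symmetric])
qed

lemma hurwitz_3I:
  assumes "f \<in> pos_polys 3" "coeff f 0 * coeff f 3 < coeff f 1 * coeff f 2"
  shows "f \<in> hurwitz 3"
proof -
  define a where "a = coeff f"
  have "degree f \<le> 3" and pos: "a 0 > 0" "a 1 > 0" "a 2 > 0" "a 3 > 0"
    using assms(1) by (auto simp: pos_polys_def a_def)
  \<comment> \<open>The remainder on dividing a3 y + a1 by a2 y + a0, where y = z^2; the quotient a3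
    / a2 serves as \<open>\<gamma>\<close>.\<close>
  have k: "a 1 - a 0 * a 3 / a 2 > 0"
    using assms(2) pos by (simp add: field_simps a_def)
  have "Re z < 0" if "poly (map_poly of_real f) z = 0" for z :: complex
  proof (rule ccontr)
    assume "\<not> Re z < 0"
    define N where "N = of_real (a 2) * z\<^sup>2 + of_real (a 0)"
    have L: "of_real (a 3 / a 2) * N + of_real (a 1 - a 0 * a 3 / a 2)
        = of_real (a 3) * z\<^sup>2 + of_real (a 1)"
      using pos(3) by (simp add: N_def field_simps)
    have "poly (map_poly of_real f) z = N + z * (of_real (a 3) * z\<^sup>2 + of_real (a 1))"
      using \<open>degree f \<le> 3\<close> by (subst poly_map_of_real_sum[of f 3])
        (simp_all add: a_def N_def numeral_eq_Suc algebra_simps)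
    moreover have "N + z * (of_real (a 3) * z\<^sup>2 + of_real (a 1)) \<noteq> 0"
      using stieltjes_fraction_nonzero[of z 0 "a 3 / a 2" 0 "a 2" "a 0" "a 1 - a 0 * a 3 / a 2"]
        \<open>\<not> Re z < 0\<close> pos k unfolding N_def[symmetric] L by simp
    ultimately show False using that by simp
  qed
  then show ?thesis using assms(1) by (simp add: hurwitz_iff stable_def)
qed

text \<open>Two Euclidean divisions in z^2 give the continued fraction: the even part by c3 y + c1
  leaves N = d y + a0, and c3 y + c1 by N leaves c1 - a0 c3 / d. The inequality \<open>ineq\<close>
  makes d and this last remainder positive. The value \<open>\<mu> = 0\<close> is the quartic;
  general \<open>\<mu>\<close> serves degree 5.\<close>

lemma quartic_core_nonzero:
  fixes z :: complex and a0 a2 a4 c1 c3 \<mu> :: real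
  assumes "Re z \<ge> 0" "\<mu> \<ge> 0" "a0 > 0" "a4 > 0" "c1 > 0" "c3 > 0"
    and ineq: "a0 * c3\<^sup>2 + c1\<^sup>2 * a4 < c1 * c3 * a2"
  shows "(of_real a4 * z ^ 4 + of_real a2 * z\<^sup>2 + of_real a0) * (1 + of_real \<mu> * z)
    + z * (of_real c3 * z\<^sup>2 + of_real c1) \<noteq> 0"
proof -
  define d where "d = a2 - a4 * c1 / c3"
  have *: "c1 * (c3 * d) = c1 * c3 * a2 - c1\<^sup>2 * a4"
    using assms(6) by (simp add: d_def field_simps power2_eq_square)
  then have "c1 * (c3 * d) > a0 * c3\<^sup>2" using ineq by linarith
  then have "c3 * (c1 * d) > c3 * (a0 * c3)" by (simp add: mult_ac power2_eq_square)
  then have k: "c1 * d > a0 * c3" using assms(6) by (simp add: mult_less_cancel_left_pos)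
  moreover have "a0 * c3 > 0" using assms(3,6) by simp
  ultimately have "c1 * d > 0" by linarith
  then have d: "d > 0" using assms(5) by (simp add: zero_less_mult_iff)
  define N where "N = of_real d * z\<^sup>2 + of_real a0"
  have L: "of_real (c3 / d) * N + of_real (c1 - a0 * c3 / d) = of_real c3 * z\<^sup>2 + of_real c1"
    using d by (simp add: N_def field_simps)
  have P: "of_real (a4 / c3) * z\<^sup>2 * (of_real c3 * z\<^sup>2 + of_real c1) + N
      = of_real a4 * z ^ 4 + of_real a2 * z\<^sup>2 + of_real a0"
    using assms(6) by (simp add: N_def d_def field_simps power2_eq_square power4_eq_xxxx)
  have "c1 - a0 * c3 / d > 0" using k d by (simp add: field_simps)
  then show ?thesis
    using stieltjes_fraction_nonzero[of z "a4 / c3" "c3 / d" \<mu> d a0 "c1 - a0 * c3 / d"] assms d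
    unfolding N_def[symmetric] L P by simp
qed

lemma hurwitz_4I:
  assumes "f \<in> pos_polys 4"
    and "coeff f 0 * coeff f 3 ^ 2 + coeff f 1 ^ 2 * coeff f 4 < coeff f 1 * coeff f 3 * coeff f 2"
  shows "f \<in> hurwitz 4"
proof -
  have deg: "degree f \<le> 4"
    and pos: "coeff f 0 > 0" "coeff f 1 > 0" "coeff f 2 > 0" "coeff f 3 > 0" "coeff f 4 > 0"
    using assms(1) by (auto simp: pos_polys_def)
  have "poly (map_poly of_real f) z = (of_real (coeff f 4) * z ^ 4 + of_real (coeff f 2) * z\<^sup>2
      + of_real (coeff f 0)) * (1 + of_real 0 * z)
      + z * (of_real (coeff f 3) * z\<^sup>2 + of_real (coeff f 1))" for z :: complex
    using deg by (subst poly_map_of_real_sum[of f 4]) (simp_all add: numeral_eq_Suc algebra_simps)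
  then show ?thesis
    using assms pos quartic_core_nonzero[of _ 0 "coeff f 0" "coeff f 4" "coeff f 1" "coeff f 3" "coeff f 2"]
    by (auto simp: hurwitz_iff stable_def not_less[symmetric] mult_ac)
qed

text \<open>The choice \<open>\<mu> = a5 / a4\<close> removes the y^2 term of q -
  \<open>\<mu>\<close> p. The Bezout form of p with itself vanishes, so the hypotheses keep their
  form with c1, c3, 0 in place of a1, a3, a5; dividing the determinant inequality by a4 leaves the
  quartic one. That in turn forces c1 > 0.\<close>

lemma quintic_reduction:
  fixes a0 a1 a2 a3 a4 a5 :: real
  assumes "a0 > 0" "a2 > 0" "a4 > 0" "a2 * a5 < a3 * a4"
    and det: "(a1 * a4 - a0 * a5)\<^sup>2 < (a1 * a2 - a0 * a3) * (a3 * a4 - a2 * a5)"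
  obtains \<mu> c1 c3 where "a1 = \<mu> * a0 + c1" "a3 = \<mu> * a2 + c3" "a5 = \<mu> * a4"
    "c1 > 0" "c3 > 0" "a0 * c3\<^sup>2 + c1\<^sup>2 * a4 < c1 * c3 * a2"
proof -
  define \<mu> c1 c3 where "\<mu> = a5 / a4" "c1 = a1 - \<mu> * a0" "c3 = a3 - \<mu> * a2"
  have eqs: "a1 = \<mu> * a0 + c1" "a3 = \<mu> * a2 + c3" "a5 = \<mu> * a4"
    using assms(3) by (simp_all add: \<mu>_c1_c3_def)
  have "a3 * a4 - a2 * a5 = c3 * a4" by (simp add: eqs algebra_simps)
  then have c3: "c3 > 0" using assms(3,4) by (metis diff_gt_0_iff_gt zero_less_mult_pos2)
  have "(c1 * a4)\<^sup>2 < (c1 * a2 - a0 * c3) * (c3 * a4)"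
    using det by (simp add: eqs algebra_simps)
  then have "a4 * (a0 * c3\<^sup>2 + c1\<^sup>2 * a4) < a4 * (c1 * c3 * a2)"
    by (simp add: algebra_simps power2_eq_square)
  then have ineq: "a0 * c3\<^sup>2 + c1\<^sup>2 * a4 < c1 * c3 * a2"
    using assms(3) by (simp only: mult_less_cancel_left_pos)
  moreover have "a0 * c3\<^sup>2 + c1\<^sup>2 * a4 > 0" using assms(1,3) c3 by (simp add: add_pos_nonneg)
  ultimately have "c1 * (c3 * a2) > 0" by (simp add: mult.assoc)
  moreover have "c3 * a2 > 0" using c3 assms(2) by simp
  ultimately have "c1 > 0" by (rule zero_less_mult_pos2)
  with eqs c3 ineq that show ?thesis by blast
qed

text \<open>The splitting of the odd part writes f(z) as p(z^2) (1 + \<open>\<mu>\<close> z) + z (c1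
  + c3 z^2), the shape treated in \<open>quartic_core_nonzero\<close>.\<close>

lemma hurwitz_5I:
  assumes "f \<in> pos_polys 5"
    and "coeff f 2 * coeff f 5 < coeff f 3 * coeff f 4"
    and "(coeff f 1 * coeff f 4 - coeff f 0 * coeff f 5)\<^sup>2
      < (coeff f 1 * coeff f 2 - coeff f 0 * coeff f 3) * (coeff f 3 * coeff f 4 - coeff f 2 * coeff f 5)"
  shows "f \<in> hurwitz 5"
proof -
  have deg: "degree f \<le> 5"
    and pos: "coeff f 0 > 0" "coeff f 2 > 0" "coeff f 4 > 0" "coeff f 5 > 0"
    using assms(1) by (auto simp: pos_polys_def)
  from quintic_reduction[OF pos(1-3) assms(2,3)] obtain \<mu> c1 c3 where
    eqs: "coeff f 1 = \<mu> * coeff f 0 + c1" "coeff f 3 = \<mu> * coeff f 2 + c3" "coeff f 5 = \<mu> * coeff f 4"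
    and c: "c1 > 0" "c3 > 0" "coeff f 0 * c3\<^sup>2 + c1\<^sup>2 * coeff f 4 < c1 * c3 * coeff f 2" .
  have "\<mu> \<ge> 0" using eqs(3) pos by (simp add: zero_less_mult_iff)
  have "poly (map_poly of_real f) z = (\<Sum>i\<le>5. of_real (coeff f i) * z ^ i)" for z :: complex
    by (rule poly_map_of_real_sum[OF deg])
  also have "(\<Sum>i\<le>5. of_real (coeff f i) * z ^ i) = of_real (coeff f 0) + of_real (coeff f 1) * z
      + of_real (coeff f 2) * z ^ 2 + of_real (coeff f 3) * z ^ 3 + of_real (coeff f 4) * z ^ 4
      + of_real (coeff f 5) * z ^ 5" for z :: complex
    by (simp add: numeral_eq_Suc)
  also have "\<dots> z = (of_real (coeff f 4) * z ^ 4 + of_real (coeff f 2) * z\<^sup>2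
      + of_real (coeff f 0)) * (1 + of_real \<mu> * z) + z * (of_real c3 * z\<^sup>2 + of_real c1)" for z :: complex
    unfolding eqs by (simp add: numeral_eq_Suc algebra_simps)
  finally show ?thesis
    using assms(1) pos c \<open>\<mu> \<ge> 0\<close> quartic_core_nonzero[of _ \<mu> "coeff f 0" "coeff f 4" c1 c3 "coeff f 2"]
    by (auto simp: hurwitz_iff stable_def not_less[symmetric])
qed

subsection \<open>Hadamard products and the inequalities\<close>

text \<open>The determinant of a positive semidefinite plus a positive definite 2 x 2 matrix. The
  mixed terms are controlled by (2 y v)^2 <= 4 (x z) (u w) <= (x w + z u)^2, the last step being the
  arithmetic-geometric mean inequality.\<close>

lemma psd_add_pd_det:
  fixes x y z u v w :: real
  assumes "x \<ge> 0" "z \<ge> 0" "y\<^sup>2 \<le> x * z" "u > 0" "w > 0" "v\<^sup>2 < u * w"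
  shows "(y + v)\<^sup>2 < (x + u) * (z + w)"
proof -
  have "(y * v)\<^sup>2 \<le> (x * z) * (u * w)"
    unfolding power_mult_distrib using assms by (intro mult_mono) auto
  moreover have "(x * w + z * u)\<^sup>2 = 4 * ((x * z) * (u * w)) + (x * w - z * u)\<^sup>2"
    and "(2 * (y * v))\<^sup>2 = 4 * (y * v)\<^sup>2"
    by algebra+
  ultimately have "(2 * (y * v))\<^sup>2 \<le> (x * w + z * u)\<^sup>2"
    using zero_le_power2[of "x * w - z * u"] by linarith
  then have "2 * (y * v) \<le> x * w + z * u"
    by (rule power2_le_imp_le) (use assms in simp)
  moreover have "(y + v)\<^sup>2 = y\<^sup>2 + 2 * (y * v) + v\<^sup>2" "(x + u) * (z + w) = x * z + (x * w + z * u) + u * w"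
    by algebra+
  ultimately show ?thesis using assms(3,6) by linarith
qed

text \<open>Both b0 b3^2 and b1^2 b4 are at most b1 b2 b3, so the left side grows by at most the
  factor b1 b2 b3 that multiplies the right side.\<close>

lemma quartic_hadamard_ineq:
  fixes a0 a2 a4 c1 c3 b0 b1 b2 b3 b4 :: real
  assumes ineq: "a0 * c3\<^sup>2 + c1\<^sup>2 * a4 < c1 * c3 * a2"
    and "a0 > 0" "a4 > 0"
    and b: "b0 > 0" "b1 > 0" "b2 > 0" "b3 > 0" "b4 > 0" "b0 * b3 \<le> b1 * b2" "b1 * b4 \<le> b2 * b3"
  shows "(a0 * b0) * (c3 * b3)\<^sup>2 + (c1 * b1)\<^sup>2 * (a4 * b4) < (c1 * b1) * (c3 * b3) * (a2 * b2)"
proof -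
  have "(a0 * c3\<^sup>2) * (b3 * (b0 * b3)) \<le> (a0 * c3\<^sup>2) * (b3 * (b1 * b2))"
    using assms by (intro mult_left_mono) auto
  moreover have "(c1\<^sup>2 * a4) * (b1 * (b1 * b4)) \<le> (c1\<^sup>2 * a4) * (b1 * (b2 * b3))"
    using assms by (intro mult_left_mono) auto
  moreover have "(a0 * c3\<^sup>2 + c1\<^sup>2 * a4) * (b1 * b2 * b3) < (c1 * c3 * a2) * (b1 * b2 * b3)"
    using ineq b by (intro mult_strict_right_mono) auto
  moreover have "(a0 * b0) * (c3 * b3)\<^sup>2 + (c1 * b1)\<^sup>2 * (a4 * b4)
      = (a0 * c3\<^sup>2) * (b3 * (b0 * b3)) + (c1\<^sup>2 * a4) * (b1 * (b1 * b4))"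
    "(c1 * b1) * (c3 * b3) * (a2 * b2) = (c1 * c3 * a2) * (b1 * b2 * b3)"
    "(a0 * c3\<^sup>2 + c1\<^sup>2 * a4) * (b1 * b2 * b3)
      = (a0 * c3\<^sup>2) * (b3 * (b1 * b2)) + (c1\<^sup>2 * a4) * (b1 * (b2 * b3))"
    by algebra+
  ultimately show ?thesis by linarith
qed

text \<open>By linearity in the odd part, the Bezout matrix of the product is a sum:
  \<open>\<mu>\<close> p contributes \<open>\<mu>\<close> times a0 a2 w11, a0 a4 w12, a2 a4 w22,
  where the w's are the Bezout entries of the b's, and c1 + c3 y contributes the rest.\<close>

lemma quintic_hadamard_ineq:
  fixes a0 a1 a2 a3 a4 a5 b0 b1 b2 b3 b4 b5 :: real
  assumes a: "a0 > 0" "a2 > 0" "a4 > 0" "a5 > 0" "a2 * a5 < a3 * a4"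
    and det: "(a1 * a4 - a0 * a5)\<^sup>2 < (a1 * a2 - a0 * a3) * (a3 * a4 - a2 * a5)"
    and b: "b0 > 0" "b1 > 0" "b2 > 0" "b3 > 0" "b4 > 0" "b0 * b3 \<le> b1 * b2" "b1 * b4 \<le> b2 * b3"
      "b2 * b5 \<le> b3 * b4"
    and det_b: "(b1 * b4 - b0 * b5)\<^sup>2 \<le> 4 * ((b1 * b2 - b0 * b3) * (b3 * b4 - b2 * b5))"
  shows "((a1 * b1) * (a4 * b4) - (a0 * b0) * (a5 * b5))\<^sup>2
    < ((a1 * b1) * (a2 * b2) - (a0 * b0) * (a3 * b3)) * ((a3 * b3) * (a4 * b4) - (a2 * b2) * (a5 * b5))"
proof -
  from quintic_reduction[OF a(1-3,5) det] obtain \<mu> c1 c3 where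
    eqs: "a1 = \<mu> * a0 + c1" "a3 = \<mu> * a2 + c3" "a5 = \<mu> * a4"
    and c: "c1 > 0" "c3 > 0" "a0 * c3\<^sup>2 + c1\<^sup>2 * a4 < c1 * c3 * a2" .
  have mu: "\<mu> > 0" using eqs(3) a(3,4) by (simp add: zero_less_mult_iff)
  define w11 w12 w22 where "w11 = b1 * b2 - b0 * b3" "w12 = b1 * b4 - b0 * b5" "w22 = b3 * b4 - b2 * b5"
  note w_def = w11_w12_w22_def
  have w: "w11 \<ge> 0" "w22 \<ge> 0" "w12\<^sup>2 \<le> 4 * (w11 * w22)" using b det_b by (simp_all add: w_def)
  \<comment> \<open>Arithmetic-geometric mean on the left side of the quartic inequality; squaring
    that inequality then yields the discriminant condition on p.\<close>
  have "4 * (a0 * a4) * (c1 * c3)\<^sup>2 \<le> (a0 * c3\<^sup>2 + c1\<^sup>2 * a4)\<^sup>2"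
  proof -
    have "(a0 * c3\<^sup>2 + c1\<^sup>2 * a4)\<^sup>2
        = 4 * (a0 * a4) * (c1 * c3)\<^sup>2 + (a0 * c3\<^sup>2 - c1\<^sup>2 * a4)\<^sup>2"
      by algebra
    then show ?thesis by simp
  qed
  also have "\<dots> \<le> (c1 * c3 * a2)\<^sup>2" using c a by (intro power_mono) auto
  also have "\<dots> = a2\<^sup>2 * (c1 * c3)\<^sup>2" by (simp add: power_mult_distrib mult_ac)
  finally have disc: "4 * (a0 * a4) \<le> a2\<^sup>2" using c(1,2) by (simp add: mult_le_cancel_right_pos)
  \<comment> \<open>The factor 4 lost in \<open>det_b\<close> is exactly what the discriminant
    condition pays for.\<close>
  have "a0 * a4 * w12\<^sup>2 \<le> a0 * a4 * (4 * (w11 * w22))" using w a by (intro mult_left_mono) auto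
  also have "\<dots> = 4 * (a0 * a4) * (w11 * w22)" by simp
  also have "\<dots> \<le> a2\<^sup>2 * (w11 * w22)" using disc w by (intro mult_right_mono) auto
  finally have "(\<mu>\<^sup>2 * (a0 * a4)) * (a0 * a4 * w12\<^sup>2) \<le> (\<mu>\<^sup>2 * (a0 * a4)) * (a2\<^sup>2 * (w11 * w22))"
    using a mu by (intro mult_left_mono) auto
  then have psd: "(\<mu> * a0 * a4 * w12)\<^sup>2 \<le> (\<mu> * a0 * a2 * w11) * (\<mu> * a2 * a4 * w22)"
    by (simp add: power2_eq_square mult_ac)
  \<comment> \<open>First diagonal entry of the c-part; its other entries are single products
    because c1 + c3 y has no y^2 term.\<close>
  define y11 where "y11 = (c1 * b1) * (a2 * b2) - (a0 * b0) * (c3 * b3)"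
  have "(a0 * b0) * (c3 * b3)\<^sup>2 + (c1 * b1)\<^sup>2 * (a4 * b4) < (c1 * b1) * (c3 * b3) * (a2 * b2)"
    using c a b by (intro quartic_hadamard_ineq) auto
  moreover have "y11 * (c3 * b3)
      = (c1 * b1) * (c3 * b3) * (a2 * b2) - (a0 * b0) * (c3 * b3)\<^sup>2"
    unfolding y11_def by algebra
  ultimately have y: "(c1 * b1)\<^sup>2 * (a4 * b4) < y11 * (c3 * b3)" by linarith
  moreover have "(c1 * b1)\<^sup>2 * (a4 * b4) > 0" using c a b by simp
  ultimately have "y11 * (c3 * b3) > 0" by linarith
  moreover have "c3 * b3 > 0" using c(2) b(4) by simp
  ultimately have y11: "y11 > 0" by (rule zero_less_mult_pos2)
  have "(c1 * b1)\<^sup>2 * (a4 * b4) * (a4 * b4) < y11 * (c3 * b3) * (a4 * b4)"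
    using y a b by (intro mult_strict_right_mono) auto
  then have pd: "((c1 * b1) * (a4 * b4))\<^sup>2 < y11 * ((c3 * b3) * (a4 * b4))"
    by (simp add: power2_eq_square mult_ac)
  have "(\<mu> * a0 * a4 * w12 + (c1 * b1) * (a4 * b4))\<^sup>2
      < (\<mu> * a0 * a2 * w11 + y11) * (\<mu> * a2 * a4 * w22 + (c3 * b3) * (a4 * b4))"
    using psd pd y11 mu a b c w by (intro psd_add_pd_det) auto
  moreover have "(a1 * b1) * (a4 * b4) - (a0 * b0) * (a5 * b5) = \<mu> * a0 * a4 * w12 + (c1 * b1) * (a4 * b4)"
    "(a1 * b1) * (a2 * b2) - (a0 * b0) * (a3 * b3) = \<mu> * a0 * a2 * w11 + y11"
    "(a3 * b3) * (a4 * b4) - (a2 * b2) * (a5 * b5) = \<mu> * a2 * a4 * w22 + (c3 * b3) * (a4 * b4)"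
    unfolding eqs w_def y11_def by algebra+
  ultimately show ?thesis by simp
qed

lemma degree_hadamard_le: "degree (hadamard f g) \<le> min (degree f) (degree g)"
  unfolding hadamard_def
  by (intro degree_sum_le) (auto intro: order_trans[OF degree_monom_le])

lemma coeff_hadamard [simp]: "coeff (hadamard f g) i = coeff f i * coeff g i"
proof (cases "i \<le> min (degree f) (degree g)")
  case True
  then show ?thesis by (simp add: hadamard_def coeff_sum)
next
  case False
  then have "coeff (hadamard f g) i = 0"
    using degree_hadamard_le[of f g] by (intro coeff_eq_0) linarith
  moreover have "coeff f i = 0 \<or> coeff g i = 0" using False by (auto intro: coeff_eq_0)
  ultimately show ?thesis by auto
qed

lemma hadamard_commute: "hadamard f g = hadamard g f"
  by (rule poly_eqI) simp

subsection \<open>Closure under coefficientwise limits\<close>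

definition weakly_stable :: "real poly \<Rightarrow> bool" where
  "weakly_stable f \<longleftrightarrow> (\<forall>z::complex. poly (map_poly of_real f) z = 0 \<longrightarrow> Re z \<le> 0)"

(* Unlike hurwitz_star, this allows a zero constant term, so that it contains Q_shift m k. *)
definition closed_hurwitz :: "nat \<Rightarrow> real poly set" where
  "closed_hurwitz n = {f. degree f = n \<and> f \<noteq> 0 \<and> (\<forall>i. coeff f i \<ge> 0) \<and> weakly_stable f}"

lemma hurwitz_star_iff:
  assumes "n \<ge> 1"
  shows "f \<in> hurwitz_star n \<longleftrightarrow> f \<in> closed_hurwitz n \<and> coeff f 0 > 0"
proof -
  have "\<forall>i. coeff f i \<ge> 0"
    if "degree f = n" "coeff f 0 > 0" "coeff f n > 0" "\<forall>i. 1 \<le> i \<and> i < n \<longrightarrow> coeff f i \<ge> 0"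
  proof
    fix i
    consider "i = 0" | "1 \<le> i \<and> i < n" | "i = n" | "i > n" by linarith
    then show "coeff f i \<ge> 0" using that by cases (auto simp: coeff_eq_0)
  qed
  moreover have "coeff f n > 0" if "degree f = n" "f \<noteq> 0" "\<forall>i. coeff f i \<ge> 0"
    using that by (metis leading_coeff_0_iff order_le_less)
  ultimately show ?thesis
    by (auto simp: hurwitz_star_def closed_hurwitz_def weakly_stable_def)
qed

lemma hurwitz_subset_hurwitz_star: "n \<ge> 1 \<Longrightarrow> hurwitz n \<subseteq> hurwitz_star n"
  by (auto simp: hurwitz_def hurwitz_star_def pos_polys_def less_imp_le)

lemma closed_hurwitz_mult:
  assumes "f \<in> closed_hurwitz m" "g \<in> closed_hurwitz n"
  shows "f * g \<in> closed_hurwitz (m + n)"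
  using assms
  by (auto simp: closed_hurwitz_def weakly_stable_def degree_mult_eq poly_map_of_real_mult coeff_mult
      intro!: sum_nonneg)

lemma closed_hurwitz_power:
  assumes "f \<in> closed_hurwitz m"
  shows "f ^ n \<in> closed_hurwitz (n * m)"
proof (induction n)
  case 0
  then show ?case by (simp add: closed_hurwitz_def weakly_stable_def one_pCons map_poly_pCons coeff_pCons split: nat.splits)
next
  case (Suc n)
  then show ?case using closed_hurwitz_mult[OF assms] by simp
qed

lemma closed_hurwitz_linear: "a \<ge> 0 \<Longrightarrow> [:a, 1:] \<in> closed_hurwitz 1"
  by (auto simp: closed_hurwitz_def weakly_stable_def map_poly_pCons coeff_pCons complex_eq_iff split: nat.splits)

lemma closed_hurwitz_square_plus_1: "[:1, 0, 1:] \<in> closed_hurwitz 2"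
proof -
  have "Re z \<le> 0" if "1 + z * z = 0" for z :: complex
  proof -
    have re: "1 + Re z * Re z = Im z * Im z" and "Re z = 0 \<or> Im z = 0"
      using that by (auto simp: complex_eq_iff)
    moreover have "Im z \<noteq> 0"
    proof
      assume "Im z = 0"
      then show False using re zero_le_square[of "Re z"] by simp
    qed
    ultimately show ?thesis by simp
  qed
  then show ?thesis
    by (auto simp: closed_hurwitz_def weakly_stable_def map_poly_pCons coeff_pCons split: nat.splits)
qed

text \<open>For odd k the two summands share a factor, so that \<open>Q_poly k\<close> is a power of
  x^2 + 1 times x + 1.\<close>

lemma closed_hurwitz_Q_poly: "Q_poly k \<in> closed_hurwitz k"
proof (cases "even k")
  case True
  then show ?thesis
    using closed_hurwitz_power[OF closed_hurwitz_square_plus_1, of "k div 2"] by (simp add: Q_poly_def)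
next
  case False
  have "Q_poly k = [:1, 0, 1:] ^ (k div 2) * [:1, 1:]"
    using False by (simp add: Q_poly_def)
  moreover have "[:1, 0, 1:] ^ (k div 2) * [:1, 1:] \<in> closed_hurwitz (k div 2 * 2 + 1)"
    by (intro closed_hurwitz_mult closed_hurwitz_power closed_hurwitz_square_plus_1
        closed_hurwitz_linear) simp
  ultimately show ?thesis using False by (metis odd_two_times_div_two_succ mult.commute)
qed

lemma closed_hurwitz_Q_shift: "Q_shift m k \<in> closed_hurwitz (m + k)"
proof -
  have "[:0, 1:] ^ m \<in> closed_hurwitz (m * 1)"
    by (intro closed_hurwitz_power closed_hurwitz_linear) simp
  then show ?thesis
    unfolding Q_shift_def
    by (intro closed_hurwitz_mult closed_hurwitz_Q_poly) (simp add: monom_altdef)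
qed

text \<open>Each coefficient of f(x + e) up to the degree is a nonnegative combination of
  coefficients of f in which the positive leading one occurs. The induction follows f(x) = a + x
  h(x).\<close>

lemma coeff_pcompose_shift_pos:
  fixes f :: "real poly"
  assumes "f \<noteq> 0" "\<And>i. coeff f i \<ge> 0" "e > 0" "i \<le> degree f"
  shows "coeff (pcompose f [:e, 1:]) i > 0"
  using assms
proof (induction f arbitrary: i)
  case 0
  then show ?case by simp
next
  case (pCons a f)
  have a: "a \<ge> 0" using pCons.prems(2)[of 0] by simp
  show ?case
  proof (cases "f = 0")
    case True
    with pCons a show ?thesis by (auto simp: pcompose_pCons)
  next
    case False
    have nonneg: "coeff f j \<ge> 0" for j using pCons.prems(2)[of "Suc j"] by simp
    have pos: "j \<le> degree f \<Longrightarrow> coeff (pcompose f [:e, 1:]) j > 0" for j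
      using pCons.IH[OF False nonneg] pCons.prems(3) by blast
    have nn: "coeff (pcompose f [:e, 1:]) j \<ge> 0" for j
      using pos[of j] by (cases "j \<le> degree f") (auto simp: coeff_eq_0 degree_pcompose)
    show ?thesis
    proof (cases i)
      case 0
      then show ?thesis using a pos[of 0] pCons.prems(3) by (simp add: pcompose_pCons add_nonneg_pos)
    next
      case (Suc j)
      then have "j \<le> degree f" using pCons.prems(4) False by simp
      then show ?thesis using Suc pos[of j] nn[of "Suc j"] pCons.prems(3)
        by (simp add: pcompose_pCons coeff_pCons add_nonneg_pos)
    qed
  qed
qed

text \<open>The shift moves every zero to the left by e, which provides the approximation of
  \<open>closed_hurwitz\<close> by \<open>hurwitz\<close>.\<close>

lemma closed_hurwitz_shift:
  assumes "f \<in> closed_hurwitz n" "e > 0"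
  shows "pcompose f [:e, 1:] \<in> hurwitz n"
proof -
  have "Re z < 0" if "poly (map_poly of_real (pcompose f [:e, 1:])) z = 0" for z :: complex
  proof -
    have "poly (map_poly of_real f) (of_real e + z) = 0"
      using that by (simp add: poly_map_of_real_pcompose map_poly_pCons)
    then have "Re (of_real e + z) \<le> 0" using assms(1) by (auto simp: closed_hurwitz_def weakly_stable_def)
    then show ?thesis using assms(2) by simp
  qed
  then show ?thesis using assms coeff_pcompose_shift_pos[of f e]
    by (auto simp: hurwitz_def pos_polys_def closed_hurwitz_def degree_pcompose)
qed

lemma tendsto_coeff_pcompose_shift:
  fixes f :: "real poly"
  shows "((\<lambda>e. coeff (pcompose f [:e, 1:]) i) \<longlongrightarrow> coeff f i) (at_right 0)"
proof (induction f arbitrary: i)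
  case 0
  then show ?case by simp
next
  case (pCons a f)
  have "((\<lambda>e. coeff [:a:] i + (e * coeff (pcompose f [:e, 1:]) i
      + (case i of 0 \<Rightarrow> 0 | Suc j \<Rightarrow> coeff (pcompose f [:e, 1:]) j)))
      \<longlongrightarrow> coeff [:a:] i + (0 * coeff f i + (case i of 0 \<Rightarrow> 0 | Suc j \<Rightarrow> coeff f j))) (at_right 0)"
    by (intro tendsto_intros pCons.IH) (auto split: nat.splits intro: pCons.IH)
  then show ?case by (cases i) (simp_all add: pcompose_pCons)
qed

text \<open>Every zero x has \<open>Re x \<le> 0\<close>, hence |z - x| >= Re z for each linear
  factor. The bound depends on the polynomial only through its degree and leading coefficient and so
  passes to limits.\<close>

lemma weakly_stable_norm_ge:
  fixes z :: complex
  assumes "weakly_stable f" "f \<noteq> 0" "Re z > 0"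
  shows "cmod (poly (map_poly of_real f) z) \<ge> \<bar>lead_coeff f\<bar> * Re z ^ degree f"
proof -
  define F :: "complex poly" where "F = map_poly of_real f"
  have deg: "degree F = degree f" by (simp add: F_def degree_map_poly)
  have "F \<noteq> 0" using assms(2) by (simp add: F_def map_poly_eq_0_iff)
  then obtain A where A: "size A = degree F" "F = smult (lead_coeff F) (\<Prod>x\<in>#A. [:- x, 1:])"
    using alg_closed_imp_factorization by blast
  have root: "poly F x = 0" if x: "x \<in># A" for x
  proof -
    obtain B where "A = add_mset x B" using multi_member_split[OF x] by blast
    then show ?thesis by (subst A(2)) simp
  qed
  \<comment> \<open>Induction over submultisets of A keeps the information that the elements are
    zeros of F.\<close>
  have "Re z ^ size B \<le> cmod (poly (\<Prod>x\<in>#B. [:- x, 1:]) z)" if "B \<subseteq># A" for B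
    using that
  proof (induction B)
    case empty
    then show ?case by simp
  next
    case (add x B)
    have "x \<in># A" using add.prems by (meson mset_subset_eqD union_single_eq_member)
    then have "Re x \<le> 0" using root assms(1) by (auto simp: weakly_stable_def F_def)
    then have "Re z \<le> cmod (z - x)" using complex_Re_le_cmod[of "z - x"] by simp
    moreover have "Re z ^ size B \<le> cmod (poly (\<Prod>x\<in>#B. [:- x, 1:]) z)"
      using add by (meson mset_subset_eq_insertD subset_mset.less_imp_le)
    ultimately have "Re z * Re z ^ size B \<le> cmod (z - x) * cmod (poly (\<Prod>x\<in>#B. [:- x, 1:]) z)"
      using assms(3) by (intro mult_mono) auto
    then show ?case by (simp add: norm_mult del: mult_pCons_left)
  qed
  then have "Re z ^ degree f \<le> cmod (poly (\<Prod>x\<in>#A. [:- x, 1:]) z)" using A(1) deg by force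
  then have "cmod (lead_coeff F) * Re z ^ degree f \<le> cmod (poly F z)"
    by (subst (2) A(2)) (simp add: norm_mult mult_left_mono)
  moreover have "lead_coeff F = of_real (lead_coeff f)" unfolding deg by (simp add: F_def coeff_map_poly)
  ultimately show ?thesis by (simp add: F_def)
qed

lemma weakly_stable_limit:
  assumes lim: "\<And>i. ((\<lambda>e. coeff (F e) i) \<longlongrightarrow> coeff f i) (at_right (0::real))"
    and F: "\<And>e. e > 0 \<Longrightarrow> degree (F e) = degree f \<and> weakly_stable (F e)"
    and "f \<noteq> 0"
  shows "weakly_stable f"
  unfolding weakly_stable_def
proof (intro allI impI)
  fix z :: complex
  assume z: "poly (map_poly of_real f) z = 0"
  define n where "n = degree f"
  show "Re z \<le> 0"
  proof (rule ccontr)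
    assume "\<not> Re z \<le> 0"
    have ev: "eventually (\<lambda>e::real. e > 0) (at_right 0)" by (simp add: eventually_at_right_less)
    have "((\<lambda>e. \<Sum>i\<le>n. of_real (coeff (F e) i) * z ^ i) \<longlongrightarrow> (\<Sum>i\<le>n. of_real (coeff f i) * z ^ i)) (at_right 0)"
      by (intro tendsto_intros lim)
    also have "(\<Sum>i\<le>n. of_real (coeff f i) * z ^ i) = 0"
      using z poly_map_of_real_sum[of f n z] by (simp add: n_def)
    finally have "((\<lambda>e. cmod (\<Sum>i\<le>n. of_real (coeff (F e) i) * z ^ i)) \<longlongrightarrow> 0) (at_right 0)"
      by (rule tendsto_norm_zero)
    moreover have "((\<lambda>e. \<bar>coeff (F e) n\<bar> * Re z ^ n) \<longlongrightarrow> \<bar>coeff f n\<bar> * Re z ^ n) (at_right 0)"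
      by (intro tendsto_intros lim)
    moreover have "eventually (\<lambda>e. \<bar>coeff (F e) n\<bar> * Re z ^ n
        \<le> cmod (\<Sum>i\<le>n. of_real (coeff (F e) i) * z ^ i)) (at_right 0)"
      using ev
    proof eventually_elim
      case (elim e)
      then have "degree (F e) = n" "weakly_stable (F e)" using F by (auto simp: n_def)
      moreover from this have "(\<Sum>i\<le>n. of_real (coeff (F e) i) * z ^ i) = poly (map_poly of_real (F e)) z"
        using poly_map_of_real_sum[of "F e" n z] by simp
      ultimately show ?case
        using weakly_stable_norm_ge[of "F e" z] \<open>\<not> Re z \<le> 0\<close> by (cases "F e = 0") auto
    qed
    ultimately have "\<bar>coeff f n\<bar> * Re z ^ n \<le> 0"
      by (intro tendsto_le[of "at_right (0::real)"]) auto
    moreover have "\<bar>coeff f n\<bar> * Re z ^ n > 0"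
      using \<open>\<not> Re z \<le> 0\<close> \<open>f \<noteq> 0\<close> by (simp add: n_def)
    ultimately show False by simp
  qed
qed

lemma degree_hadamard_pos_polys:
  assumes "g \<in> pos_polys n" "degree f = m" "f \<noteq> 0" "m \<le> n"
  shows "degree (hadamard f g) = m"
proof (rule antisym)
  show "degree (hadamard f g) \<le> m" using degree_hadamard_le[of f g] assms(2) by simp
  show "m \<le> degree (hadamard f g)"
    using assms by (intro le_degree) (auto simp: pos_polys_def)
qed

text \<open>The hypothesis \<open>pres\<close> follows from preservation of \<open>hurwitz\<close>
  as well as of \<open>hurwitz_star\<close>, so one limit argument along f(x + e) serves both
  equivalences.\<close>

lemma closed_hurwitz_hadamard:
  assumes g: "g \<in> pos_polys n"
    and pres: "\<And>h. h \<in> hurwitz m \<Longrightarrow> hadamard h g \<in> hurwitz_star m"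
    and f: "f \<in> closed_hurwitz m" and "m \<le> n"
  shows "hadamard f g \<in> closed_hurwitz m"
proof -
  have f0: "f \<noteq> 0" "degree f = m" "\<And>i. coeff f i \<ge> 0" using f by (auto simp: closed_hurwitz_def)
  have deg: "degree (hadamard f g) = m" by (rule degree_hadamard_pos_polys[OF g f0(2,1) \<open>m \<le> n\<close>])
  have g0: "coeff g i \<ge> 0" for i
    using g by (cases "i \<le> n") (auto simp: pos_polys_def less_imp_le coeff_eq_0)
  have "coeff (hadamard f g) m \<noteq> 0" using f0 g \<open>m \<le> n\<close> by (auto simp: pos_polys_def)
  then have nz: "hadamard f g \<noteq> 0" by force
  have "weakly_stable (hadamard f g)"
  proof (rule weakly_stable_limit[where F = "\<lambda>e. hadamard (pcompose f [:e, 1:]) g"])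
    show "((\<lambda>e. coeff (hadamard (pcompose f [:e, 1:]) g) i) \<longlongrightarrow> coeff (hadamard f g) i) (at_right 0)" for i
      unfolding coeff_hadamard by (intro tendsto_intros tendsto_coeff_pcompose_shift)
  next
    fix e :: real
    assume "e > 0"
    then have "hadamard (pcompose f [:e, 1:]) g \<in> hurwitz_star m" by (intro pres closed_hurwitz_shift f)
    then show "degree (hadamard (pcompose f [:e, 1:]) g) = degree (hadamard f g)
        \<and> weakly_stable (hadamard (pcompose f [:e, 1:]) g)"
      by (auto simp: deg hurwitz_star_def weakly_stable_def)
  qed (rule nz)
  then show ?thesis using deg nz f0(3) g0 by (simp add: closed_hurwitz_def)
qed

text \<open>The strict inequality holds for f(x + e) with e > 0 and becomes weak as e tends to
  0.\<close>

lemma closed_hurwitz_3_ineq: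
  assumes "f \<in> closed_hurwitz 3"
  shows "coeff f 0 * coeff f 3 \<le> coeff f 1 * coeff f 2"
proof -
  define F where "F = (\<lambda>e. pcompose f [:e, 1:])"
  have ev: "eventually (\<lambda>e. F e \<in> hurwitz 3) (at_right 0)"
    using closed_hurwitz_shift[OF assms]
    by (auto simp: F_def intro: eventually_mono[OF eventually_at_right_less[of 0]])
  show ?thesis
  proof (rule tendsto_le)
    show "((\<lambda>e. coeff (F e) 0 * coeff (F e) 3) \<longlongrightarrow> coeff f 0 * coeff f 3) (at_right 0)"
      "((\<lambda>e. coeff (F e) 1 * coeff (F e) 2) \<longlongrightarrow> coeff f 1 * coeff f 2) (at_right 0)"
      unfolding F_def by (intro tendsto_intros tendsto_coeff_pcompose_shift)+
    show "eventually (\<lambda>e. coeff (F e) 0 * coeff (F e) 3 \<le> coeff (F e) 1 * coeff (F e) 2) (at_right 0)"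
      using ev by eventually_elim (intro less_imp_le stable_degree_3, auto simp: hurwitz_iff pos_polys_def)
  qed simp
qed

lemma closed_hurwitz_5_ineq:
  assumes "f \<in> closed_hurwitz 5"
  shows "coeff f 0 * coeff f 3 \<le> coeff f 1 * coeff f 2"
    and "coeff f 2 * coeff f 5 \<le> coeff f 3 * coeff f 4"
    and "(coeff f 1 * coeff f 4 - coeff f 0 * coeff f 5)\<^sup>2
      \<le> (coeff f 1 * coeff f 2 - coeff f 0 * coeff f 3) * (coeff f 3 * coeff f 4 - coeff f 2 * coeff f 5)"
proof -
  define F where "F = (\<lambda>e. pcompose f [:e, 1:])"
  have ev: "eventually (\<lambda>e. stable (F e) \<and> degree (F e) = 5) (at_right 0)"
    using closed_hurwitz_shift[OF assms]
    by (auto simp: F_def hurwitz_iff pos_polys_def intro: eventually_mono[OF eventually_at_right_less[of 0]])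
  have lim: "((\<lambda>e. coeff (F e) i) \<longlongrightarrow> coeff f i) (at_right 0)" for i
    unfolding F_def by (rule tendsto_coeff_pcompose_shift)
  show "coeff f 0 * coeff f 3 \<le> coeff f 1 * coeff f 2"
    by (rule tendsto_le[OF _ tendsto_mult[OF lim lim] tendsto_mult[OF lim lim]], simp)
      (use ev in eventually_elim, intro less_imp_le stable_degree_5(1), auto)
  show "coeff f 2 * coeff f 5 \<le> coeff f 3 * coeff f 4"
    by (rule tendsto_le[OF _ tendsto_mult[OF lim lim] tendsto_mult[OF lim lim]], simp)
      (use ev in eventually_elim, intro less_imp_le stable_degree_5(2), auto)
  show "(coeff f 1 * coeff f 4 - coeff f 0 * coeff f 5)\<^sup>2
      \<le> (coeff f 1 * coeff f 2 - coeff f 0 * coeff f 3) * (coeff f 3 * coeff f 4 - coeff f 2 * coeff f 5)"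
    by (rule tendsto_le[OF _ tendsto_mult[OF tendsto_diff[OF tendsto_mult[OF lim lim] tendsto_mult[OF lim lim]]
          tendsto_diff[OF tendsto_mult[OF lim lim] tendsto_mult[OF lim lim]]]
        tendsto_power[OF tendsto_diff[OF tendsto_mult[OF lim lim] tendsto_mult[OF lim lim]]]], simp)
      (use ev in eventually_elim, intro less_imp_le stable_degree_5(3), auto)
qed

subsection \<open>The equivalences\<close>

lemma coeff_0_Q_poly: "coeff (Q_poly k) 0 = 1"
  by (simp add: Q_poly_def flip: poly_0_coeff_0)

text \<open>\<open>Q_shift m k\<close> lies in \<open>closed_hurwitz (m + k)\<close>, hence so does
  its product with g; dividing by x^m only removes zeros at the origin. The new constant term is the
  coefficient of g at m, since \<open>Q_poly k\<close> has constant term 1.\<close>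

lemma Y_setI:
  assumes g: "g \<in> pos_polys n"
    and pres: "\<And>m f. 1 \<le> m \<Longrightarrow> m \<le> n \<Longrightarrow> f \<in> closed_hurwitz m \<Longrightarrow> hadamard f g \<in> closed_hurwitz m"
  shows "g \<in> Y_set n"
proof -
  have "hadamard g (Q_shift m k) div monom 1 m \<in> hurwitz_star k" if km: "2 \<le> k" "k + m \<le> n" for k m
  proof -
    define p where "p = hadamard g (Q_shift m k)"
    have p: "p \<in> closed_hurwitz (m + k)"
      unfolding p_def hadamard_commute[of g]
      by (rule pres) (use km closed_hurwitz_Q_shift in auto)
    have "monom 1 m dvd p"
      unfolding monom_1_dvd_iff' by (simp add: p_def Q_shift_def coeff_monom_mult)
    then obtain h where h: "p = monom 1 m * h" by (elim dvdE)
    then have coeff_h: "coeff h i = coeff p (m + i)" for i by (simp add: coeff_monom_mult)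
    have "p \<noteq> 0" using p by (simp add: closed_hurwitz_def)
    then have "h \<noteq> 0" using h by auto
    then have "degree p = m + degree h" by (simp add: h degree_mult_eq degree_monom_eq)
    then have "degree h = k" using p by (simp add: closed_hurwitz_def)
    moreover have "weakly_stable h"
      using p by (auto simp: closed_hurwitz_def weakly_stable_def h poly_map_of_real_mult)
    ultimately have "h \<in> closed_hurwitz k"
      using p \<open>h \<noteq> 0\<close> by (auto simp: closed_hurwitz_def coeff_h)
    moreover have "coeff h 0 > 0"
      using g km by (simp add: coeff_h p_def Q_shift_def coeff_monom_mult coeff_0_Q_poly pos_polys_def)
    ultimately have "h \<in> hurwitz_star k" using km by (simp add: hurwitz_star_iff)
    moreover have "p div monom 1 m = h" unfolding h by simp
    ultimately show ?thesis by (simp add: p_def)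
  qed
  then show ?thesis using g by (simp add: Y_set_def)
qed

lemma pos_polys_hadamard:
  assumes "f \<in> pos_polys m" "g \<in> pos_polys n" "m \<le> n"
  shows "hadamard f g \<in> pos_polys m"
proof -
  have "f \<noteq> 0" "degree f = m" using assms(1) by (auto simp: pos_polys_def)
  then show ?thesis
    using assms degree_hadamard_pos_polys[OF assms(2)] by (auto simp: pos_polys_def)
qed

text \<open>The two test polynomials are used only through inequalities for the coefficients of g;
  these carry each Routh-Hurwitz inequality from f to the product.\<close>

lemma hurwitz_hadamard:
  assumes g: "g \<in> pos_polys 5"
    and Q5: "hadamard g (Q_poly 5) \<in> hurwitz_star 5"
    and Q3: "hadamard g (Q_shift 1 3) div [:0, 1:] \<in> hurwitz_star 3"
    and m: "m \<in> {1..5}" and f: "f \<in> hurwitz m"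
  shows "hadamard f g \<in> hurwitz m"
proof -
  define b where "b = coeff g"
  have bpos: "b 0 > 0" "b 1 > 0" "b 2 > 0" "b 3 > 0" "b 4 > 0" "b 5 > 0"
    using g by (auto simp: pos_polys_def b_def)
  \<comment> \<open>The two middle coefficients 2 double both diagonal Bezout entries but leave the
    off-diagonal one unchanged, whence the factor 4.\<close>
  have "Q_poly 5 = [:1, 1, 2, 2, 1, 1:]" by (simp add: Q_poly_def power2_eq_square)
  moreover have "hadamard g (Q_poly 5) \<in> closed_hurwitz 5" using Q5 by (simp add: hurwitz_star_iff)
  note closed_hurwitz_5_ineq[OF this]
  ultimately have b5: "b 0 * b 3 \<le> b 1 * b 2" "b 2 * b 5 \<le> b 3 * b 4"
    "(b 1 * b 4 - b 0 * b 5)\<^sup>2 \<le> 4 * ((b 1 * b 2 - b 0 * b 3) * (b 3 * b 4 - b 2 * b 5))"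
    by (simp_all add: numeral_eq_Suc b_def algebra_simps)
  have "Q_poly 3 = [:1, 1, 1, 1:]" by (simp add: Q_poly_def)
  then have "hadamard g (Q_shift 1 3) = [:0, 1:] * [:b 1, b 2, b 3, b 4:]"
    by (intro poly_eqI) (simp add: Q_shift_def coeff_monom_mult coeff_pCons b_def numeral_eq_Suc split: nat.splits)
  then have "hadamard g (Q_shift 1 3) div [:0, 1:] = [:b 1, b 2, b 3, b 4:]"
    by (metis nonzero_mult_div_cancel_left pCons_eq_0_iff zero_neq_one)
  then have "[:b 1, b 2, b 3, b 4:] \<in> closed_hurwitz 3" using Q3 by (simp add: hurwitz_star_iff)
  from closed_hurwitz_3_ineq[OF this] have b3: "b 1 * b 4 \<le> b 2 * b 3" by (simp add: numeral_eq_Suc)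
  have st: "stable f" and fpos: "f \<in> pos_polys m" using f by (auto simp: hurwitz_iff)
  have deg: "degree f = m" and apos: "\<And>i. i \<le> m \<Longrightarrow> coeff f i > 0" using fpos by (auto simp: pos_polys_def)
  have fg: "hadamard f g \<in> pos_polys m" using pos_polys_hadamard[OF fpos g] m by simp
  \<comment> \<open>A strict inequality for f times a weak one for g; used in degrees 3 and
    5.\<close>
  have mult_less: "(a * x) * (c * y) < (p * u) * (q * v)"
    if "a * c < p * q" "x * y \<le> u * v" "a > 0" "c > 0" "x > 0" "y > 0" for a c p q x y u v :: real
  proof -
    have "(a * c) * (x * y) < (p * q) * (u * v)"
      by (rule mult_less_le_imp_less) (use that in auto)
    then show ?thesis by (simp add: mult_ac)
  qed
  consider "m = 1" | "m = 2" | "m = 3" | "m = 4" | "m = 5" using m by force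
  then show ?thesis
  proof cases
    case 1
    then show ?thesis using fg hurwitz_1I by simp
  next
    case 2
    then show ?thesis using fg hurwitz_2I by simp
  next
    case 3
    then show ?thesis
      using fg b5(1) stable_degree_3[OF st] deg apos bpos
      by (auto simp: b_def intro!: hurwitz_3I mult_less)
  next
    case 4
    then show ?thesis
      using fg b5(1) b3 stable_degree_4[OF st] deg apos bpos
      by (auto simp: b_def intro!: hurwitz_4I quartic_hadamard_ineq)
  next
    case 5
    then show ?thesis
      using fg b5 b3 stable_degree_5[OF st] deg apos bpos
      by (auto simp: b_def intro!: hurwitz_5I mult_less quintic_hadamard_ineq)
  qed
qed

theorem theorem9:
  shows "(\<forall>g \<in> pos_polys 5.
      ((\<forall>m\<in>{1..5}. \<forall>f\<in>hurwitz m. hadamard f g \<in> hurwitz m) \<longleftrightarrow>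
        hadamard g (Q_poly 5) \<in> hurwitz_star 5 \<and>
        hadamard g (Q_shift 1 3) div [:0, 1:] \<in> hurwitz_star 3) \<and>
      ((\<forall>m\<in>{1..5}. \<forall>f\<in>hurwitz_star m. hadamard f g \<in> hurwitz_star m) \<longleftrightarrow>
        hadamard g (Q_poly 5) \<in> hurwitz_star 5 \<and>
        hadamard g (Q_shift 1 3) div [:0, 1:] \<in> hurwitz_star 3)) \<and>
    X_set 5 = Y_set 5"
proof -
  define C where "C g \<longleftrightarrow> hadamard g (Q_poly 5) \<in> hurwitz_star 5 \<and>
        hadamard g (Q_shift 1 3) div [:0, 1:] \<in> hurwitz_star 3" for g
  define S where "S g \<longleftrightarrow> (\<forall>m\<in>{1..5}. \<forall>f\<in>hurwitz m. hadamard f g \<in> hurwitz m)" for g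
  define W where "W g \<longleftrightarrow> (\<forall>m\<in>{1..5}. \<forall>f\<in>hurwitz_star m. hadamard f g \<in> hurwitz_star m)" for g
  have Y_imp_C: "C g" if "g \<in> Y_set 5" for g
  proof -
    have Y: "hadamard g (Q_shift m k) div monom 1 m \<in> hurwitz_star k" if "2 \<le> k" "k + m \<le> 5" for k m
      using \<open>g \<in> Y_set 5\<close> that by (simp add: Y_set_def)
    have "monom 1 0 = (1 :: real poly)" "monom 1 1 = ([:0, 1:] :: real poly)"
      by (simp_all add: monom_altdef)
    \<comment> \<open>The two test conditions are the instances (k, m) = (5, 0) and (3, 1).\<close>
    with Y[of 5 0] Y[of 3 1] show ?thesis by (simp add: C_def Q_shift_def)
  qed
  have C_imp_S: "S g" if "g \<in> pos_polys 5" "C g" for g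
    using that hurwitz_hadamard unfolding C_def S_def by blast
  have closed: "hadamard f g \<in> closed_hurwitz m"
    if "g \<in> pos_polys 5" "S g \<or> W g" "1 \<le> m" "m \<le> 5" "f \<in> closed_hurwitz m" for g m f
    using that(1) _ that(5,4)
  proof (rule closed_hurwitz_hadamard)
    fix h assume "h \<in> hurwitz m"
    then show "hadamard h g \<in> hurwitz_star m"
      using that hurwitz_subset_hurwitz_star[of m] by (auto simp: S_def W_def)
  qed
  have SW_imp_Y: "g \<in> Y_set 5" if "g \<in> pos_polys 5" "S g \<or> W g" for g
    using that closed by (intro Y_setI) auto
  have S_imp_W: "W g" if g: "g \<in> pos_polys 5" "S g" for g
    using closed[OF g(1)] g by (auto simp: W_def hurwitz_star_iff pos_polys_def)
  \<comment> \<open>The implications form the cycle C to S to W to membership in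
    \<open>Y_set 5\<close> and back to C.\<close>
  have "S g \<longleftrightarrow> C g" "W g \<longleftrightarrow> C g" "S g \<longleftrightarrow> g \<in> Y_set 5" if "g \<in> pos_polys 5" for g
    using that Y_imp_C C_imp_S SW_imp_Y S_imp_W by blast+
  moreover have "X_set 5 = {g \<in> pos_polys 5. S g}" "Y_set 5 \<subseteq> pos_polys 5"
    by (auto simp: X_set_def S_def Y_set_def)
  ultimately have "(\<forall>g\<in>pos_polys 5. (S g \<longleftrightarrow> C g) \<and> (W g \<longleftrightarrow> C g)) \<and> X_set 5 = Y_set 5" by blast
  then show ?thesis unfolding S_def W_def C_def .
qed

end
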